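(* Let $G$ be a finite graph. Then, as functions of the weight $p$ on $V(G)$, $$\alpha_G=\mathfrak{B}^2\alpha_G,\qquad \alpha^*_G=\mathfrak{B}^2\alpha^*_G,\qquad \vartheta_G=\mathfrak{B}^2\vartheta_G.$$ Moreover, if the function $p\mapsto\Theta_G(p)$ is not convex, then $\Theta_G\neq\mathfrak{B}^2\Theta_G$.
   Context: Graphs are finite, undirected and loopless, with vertex set $V=V(G)$, $|V|=n\ge1$; $u\sim v$ means $u,v$ are adjacent. The complement $\overline{G}$ has the same vertices, and two distinct vertices are adjacent in $\overline{G}$ iff they are not adjacent in $G$. A weight on $G$ is a function $p:V\to[0,\infty)$; weights are identified with elements of $\mathbb{R}^n_+$ (vectors with nonnegative coordinates), and $\langle p,q\rangle=\sum_{v\in V}p(v)q(v)$. For a function $f:\mathbb{R}^n_+\to[0,\infty)$ with $f(q)>0$ for $q\ne0$, the transform is $(\mathfrak{B}f)(p)=\sup_{q\in\mathbb{R}^n_+,\,q\neq0}\frac{\langle p,q\rangle}{f(q)}$, and $\mathfrak{B}^2f=\mathfrak{B}(\mathfrak{B}f)$. Convexity of $f$ means $f(\mu p_1+(1-\mu)p_2)\le\mu f(p_1)+(1-\mu)f(p_2)$ for $p_1,p_2\in\mathbb{R}^n_+$, $\mu\in[0,1]$. Weighted independence number: $\alpha_G(p)=\max_I\sum_{v\in I}p(v)$, over independent sets $I\subset V$ (distinct vertices of $I$ are non-adjacent). Weighted fractional packing number: $\alpha^*_G(p)=\max_q\sum_{v\in V}p(v)q(v)$, over $q:V\to[0,1]$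 with $\sum_{v\in C}q(v)\le1$ for all cliques $C$ of $G$ (a clique is a set of vertices any two distinct members of which are adjacent). Weighted Lovász number: an orthonormal representation of a graph $G$ with $n$ vertices is an assignment $v\mapsto\psi_v\in\mathbb{R}^n$ of unit vectors such that $\psi_u\perp\psi_v$ whenever $u\ne v$ are non-adjacent in $G$. Then $\vartheta_G(p)=\max_{c,\psi}\sum_{v\in V}p(v)|\langle c,\psi_v\rangle|^2$, where $c$ ranges over unit vectors of $\mathbb{R}^n$ and $\psi$ over orthonormal representations of $\overline{G}$. Weighted Shannon capacity: the strong product $G_1\boxtimes G_2$ has vertex set $V(G_1)\times V(G_2)$, with $(u_1,v_1)\sim(u_2,v_2)$ iff ($u_1\sim u_2$ and $v_1\sim v_2$) or ($u_1\sim u_2$ and $v_1=v_2$) or ($u_1=u_2$ and $v_1\sim v_2$). $G^{\boxtimes m}$ is the $m$-fold strong product, $p^{\otimes m}(v_1,\dots,v_m)=\prod_ip(v_i)$, and $\Theta_G(p)=\lim_{m\to\infty}\sqrt[m]{\alpha_{G^{\boxtimes m}}(p^{\otimes m})}$. *)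

theory Defs
  imports "HOL-Analysis.Analysis"
begin

text \<open>
  A graph is a symmetric irreflexive adjacency relation on a vertex set. The given graph has the
  whole (finite, automatically nonempty) type \<open>'v\<close> as its vertex set, so that
  \<^typ>\<open>real ^ 'v\<close> is the space of dimension \<open>n\<close>; its strong powers live on
  lists of length \<open>m\<close>. Hence \<open>weighted_indep\<close> takes an explicit vertex set.
\<close>

type_synonym 'a adj = "'a \<Rightarrow> 'a \<Rightarrow> bool"

definition complement :: "'a adj \<Rightarrow> 'a adj" where
  "complement E = (\<lambda>u v. u \<noteq> v \<and> \<not> E u v)"

definition independent :: "'a adj \<Rightarrow> 'a set \<Rightarrow> bool" where
  "independent E I \<longleftrightarrow> pairwise (\<lambda>u v. \<not> E u v) I"

definition clique :: "'a adj \<Rightarrow> 'a set \<Rightarrow> bool" where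
  "clique E C \<longleftrightarrow> pairwise E C"

definition strong_prod :: "'a adj \<Rightarrow> 'b adj \<Rightarrow> ('a \<times> 'b) adj" where
  "strong_prod E F = (\<lambda>(u1, v1) (u2, v2).
     E u1 u2 \<and> F v1 v2 \<or> E u1 u2 \<and> v1 = v2 \<or> u1 = u2 \<and> F v1 v2)"

text \<open>
  The vertices of the \<open>m\<close>-th strong power are the lists of length \<open>m\<close>. A list of length
  \<open>Suc m\<close> is identified with the pair of its head and its tail; the \<open>0\<close>-th power is the
  one-vertex graph.
\<close>

definition power_verts :: "nat \<Rightarrow> 'a list set" where
  "power_verts m = {vs. length vs = m}"

primrec strong_power :: "'a adj \<Rightarrow> nat \<Rightarrow> 'a list adj" where
  "strong_power E 0 = (\<lambda>us vs. False)"
| "strong_power E (Suc m) = (\<lambda>us vs.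
     strong_prod E (strong_power E m) (hd us, tl us) (hd vs, tl vs))"

definition weights :: "(real ^ 'v::finite) set" where
  "weights = {p. \<forall>v. 0 \<le> p $ v}"

text \<open>
  The supremum is taken in \<^typ>\<open>real\<close>, so \<open>transform f p\<close> is meaningful only where the
  quotients are bounded above, e.g. if \<open>f\<close> is bounded below by a positive multiple of the norm.
\<close>

definition transform :: "(real ^ 'v::finite \<Rightarrow> real) \<Rightarrow> real ^ 'v \<Rightarrow> real" where
  "transform f p = (SUP q \<in> weights - {0}. (p \<bullet> q) / f q)"

definition weighted_indep :: "'a set \<Rightarrow> 'a adj \<Rightarrow> ('a \<Rightarrow> real) \<Rightarrow> real" where
  "weighted_indep V E p = Max {\<Sum>v\<in>I. p v | I. I \<subseteq> V \<and> independent E I}"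

definition independence_number :: "'v::finite adj \<Rightarrow> real ^ 'v \<Rightarrow> real" where
  "independence_number E p = weighted_indep UNIV E (\<lambda>v. p $ v)"

definition fractional_packings :: "'v::finite adj \<Rightarrow> (real ^ 'v) set" where
  "fractional_packings E =
     {q. (\<forall>v. 0 \<le> q $ v \<and> q $ v \<le> 1) \<and> (\<forall>C. clique E C \<longrightarrow> (\<Sum>v\<in>C. q $ v) \<le> 1)}"

definition fractional_packing_number :: "'v::finite adj \<Rightarrow> real ^ 'v \<Rightarrow> real" where
  "fractional_packing_number E p = (SUP q \<in> fractional_packings E. \<Sum>v\<in>UNIV. p $ v * q $ v)"

definition orthonormal_rep :: "'v::finite adj \<Rightarrow> ('v \<Rightarrow> real ^ 'v) \<Rightarrow> bool" where
  "orthonormal_rep E \<psi> \<longleftrightarrow>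
     (\<forall>v. norm (\<psi> v) = 1) \<and> (\<forall>u v. u \<noteq> v \<and> \<not> E u v \<longrightarrow> orthogonal (\<psi> u) (\<psi> v))"

definition lovasz_number :: "'v::finite adj \<Rightarrow> real ^ 'v \<Rightarrow> real" where
  "lovasz_number E p =
     Sup {\<Sum>v\<in>UNIV. p $ v * \<bar>c \<bullet> \<psi> v\<bar>\<^sup>2 | c \<psi>. norm c = 1 \<and> orthonormal_rep (complement E) \<psi>}"

definition shannon_capacity :: "'v::finite adj \<Rightarrow> real ^ 'v \<Rightarrow> real" where
  "shannon_capacity E p = lim (\<lambda>m. root m
     (weighted_indep (power_verts m) (strong_power E m) (\<lambda>vs. \<Prod>v\<leftarrow>vs. p $ v)))"

text \<open>
  The suprema defining the fractional packing number and the Lovasz number are maxima.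
\<close>

lemma fractional_packing_number_attained:
  fixes p :: "real ^ 'v::finite"
  shows "\<exists>q \<in> fractional_packings E. fractional_packing_number E p = (\<Sum>v\<in>UNIV. p $ v * q $ v) \<and>
    (\<forall>r \<in> fractional_packings E. (\<Sum>v\<in>UNIV. p $ v * r $ v) \<le> (\<Sum>v\<in>UNIV. p $ v * q $ v))"
proof -
  let ?F = "\<lambda>q :: real ^ 'v. \<Sum>v\<in>UNIV. p $ v * q $ v"
  have "fractional_packings E = cbox 0 (\<chi> v. 1) \<inter> (\<Inter>C\<in>{C. clique E C}. {q. (\<Sum>v\<in>C. q $ v) \<le> 1})"
    by (auto simp: fractional_packings_def mem_box_cart)
  moreover have "closed {q :: real ^ 'v. (\<Sum>v\<in>C. q $ v) \<le> 1}" for C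
    by (intro closed_Collect_le continuous_intros)
  ultimately have "compact (fractional_packings E)"
    by (auto intro!: compact_Int_closed)
  moreover have "0 \<in> fractional_packings E"
    by (simp add: fractional_packings_def)
  moreover have "continuous_on (fractional_packings E) ?F"
    by (intro continuous_intros)
  ultimately obtain q where q: "q \<in> fractional_packings E" "\<forall>r \<in> fractional_packings E. ?F r \<le> ?F q"
    using continuous_attains_sup[of "fractional_packings E" ?F] by blast
  then have "fractional_packing_number E p = ?F q"
    unfolding fractional_packing_number_def by (intro cSup_eq_maximum) auto
  with q show ?thesis by blast
qed

lemma lovasz_number_attained:
  fixes p :: "real ^ 'v::finite"
  shows "\<exists>c \<psi>. norm c = 1 \<and> orthonormal_rep (complement E) \<psi> \<and>
    lovasz_number E p = (\<Sum>v\<in>UNIV. p $ v * \<bar>c \<bullet> \<psi> v\<bar>\<^sup>2) \<and>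
    (\<forall>d \<phi>. norm d = 1 \<and> orthonormal_rep (complement E) \<phi> \<longrightarrow>
      (\<Sum>v\<in>UNIV. p $ v * \<bar>d \<bullet> \<phi> v\<bar>\<^sup>2) \<le> (\<Sum>v\<in>UNIV. p $ v * \<bar>c \<bullet> \<psi> v\<bar>\<^sup>2))"
proof -
  define F where "F = (\<lambda>x :: (real ^ 'v) \<times> (real ^ 'v ^ 'v). \<Sum>v\<in>UNIV. p $ v * \<bar>fst x \<bullet> (snd x $ v)\<bar>\<^sup>2)"
  define S where "S = {x :: (real ^ 'v) \<times> (real ^ 'v ^ 'v).
    norm (fst x) = 1 \<and> orthonormal_rep (complement E) (($) (snd x))}"
  have eq: "S = {x. norm (fst x) = 1} \<inter> (\<Inter>v. {x. norm (snd x $ v) = 1}) \<inter>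
      (\<Inter>u. \<Inter>v\<in>{v. u \<noteq> v \<and> \<not> complement E u v}. {x. (snd x $ u) \<bullet> (snd x $ v) = 0})"
    by (auto simp: S_def orthonormal_rep_def orthogonal_def)
  have "closed S"
    unfolding eq by (intro closed_Int closed_INT ballI closed_Collect_eq continuous_intros)
  moreover have "bounded S"
  proof -
    have "norm x \<le> 1 + real CARD('v)" if "x \<in> S" for x
    proof -
      have "norm (snd x) \<le> (\<Sum>v\<in>UNIV. norm (snd x $ v))"
        unfolding norm_vec_def by (rule L2_set_le_sum) simp
      also have "\<dots> = real CARD('v)"
        using that by (simp add: S_def orthonormal_rep_def)
      finally show ?thesis
        using that norm_Pair_le[of "fst x" "snd x"] by (simp add: S_def)
    qed
    then show ?thesis unfolding bounded_iff by blast
  qed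
  ultimately have "compact S" by (simp add: compact_eq_bounded_closed)
  moreover have "(axis (undefined :: 'v) 1, \<chi> v. axis v 1) \<in> S"
    by (simp add: S_def orthonormal_rep_def orthogonal_def inner_axis_axis)
  moreover have "continuous_on S F"
    unfolding F_def by (intro continuous_intros)
  ultimately obtain x where x: "x \<in> S" "\<forall>y\<in>S. F y \<le> F x"
    using continuous_attains_sup[of S F] by blast
  have le: "(\<Sum>v\<in>UNIV. p $ v * \<bar>d \<bullet> \<phi> v\<bar>\<^sup>2) \<le> F x"
    if "norm d = 1 \<and> orthonormal_rep (complement E) \<phi>" for d \<phi>
  proof -
    have "(($) (\<chi> v. \<phi> v)) = \<phi>" by auto
    with that have "(d, \<chi> v. \<phi> v) \<in> S" by (simp add: S_def)
    with x(2) have "F (d, \<chi> v. \<phi> v) \<le> F x" by blast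
    then show ?thesis by (simp add: F_def)
  qed
  have "lovasz_number E p = F x"
    unfolding lovasz_number_def using x(1) le
    by (intro cSup_eq_maximum) (auto simp: S_def F_def)
  then show ?thesis
    using x(1) le by (intro exI[of _ "fst x"] exI[of _ "($) (snd x)"]) (auto simp: S_def F_def)
qed

end

theory Submission
  imports Defs
begin

text \<open>
  Put \<open>g = transform f\<close> for a function \<open>f\<close> that is at least every coordinate of its
  argument; \<open>\<alpha>\<close>, \<open>\<alpha>\<^sup>*\<close>, \<open>\<vartheta>\<close> and
  \<open>\<Theta>\<close> all are, since a single vertex is an independent set.
  By construction \<open>g\<close> is the smallest function on the weights with
  \<open>p \<bullet> q \<le> f p * g q\<close> for all nonzero \<open>p\<close> (\<open>inner_le_transform\<close>).
  Reading this inequality with the roles of \<open>p\<close> and \<open>q\<close> exchanged gives \<open>transform g \<le> f\<close>. So only \<open>f \<le> transform g\<close> can fail.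

  It holds when \<open>f p\<close> is the maximum of \<open>p \<bullet> s\<close> over a set \<open>S\<close> of weights
  (\<open>transform_transform_max_linear\<close>): each \<open>s \<in> S\<close> has \<open>s \<bullet> r \<le> f r\<close> for
  all \<open>r\<close>, hence \<open>g s \<le> 1\<close>, and a maximiser \<open>s\<close> for \<open>p\<close> gives
  \<open>transform g p \<ge> (p \<bullet> s) / g s \<ge> p \<bullet> s = f p\<close>. The definitions of
  \<open>\<alpha>\<close>, \<open>\<alpha>\<^sup>*\<close> and \<open>\<vartheta>\<close> are such maxima, over the indicator
  vectors of independent sets, the fractional packings, and the vectors with entries
  \<open>\<bar>c \<bullet> \<psi> v\<bar>\<^sup>2\<close>.

  For the Shannon capacity, \<open>transform g\<close> is a pointwise finite supremum of linear functions of
  \<open>p\<close>, hence convex (\<open>convex_on_transform_transform\<close>), so \<open>\<Theta>\<close> is convex if it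
  equals its double transform. Finiteness rests on \<open>\<Theta>\<close> dominating the coordinates, and
  that in turn needs the limit defining \<open>\<Theta>\<close> to exist: the weighted independence numbers of
  strong powers are supermultiplicative, so this is Fekete's lemma.
\<close>

section \<open>The transform of a function that dominates the coordinates\<close>

text \<open>
  This bound keeps the quotients in the transform bounded and makes \<open>f\<close> positive on nonzero
  weights. For the graph parameters it expresses that a single vertex is an independent set.
\<close>

definition dominates_coordinates :: "(real ^ 'v::finite \<Rightarrow> real) \<Rightarrow> bool" where
  "dominates_coordinates f \<longleftrightarrow> (\<forall>p\<in>weights. \<forall>v. p $ v \<le> f p)"

lemma axis_in_weights: "axis v 1 \<in> weights - {0 :: real ^ 'v::finite}"
  by (auto simp: weights_def axis_def vec_eq_iff)

lemma convex_weights: "convex weights"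
  by (auto simp: convex_def weights_def)

lemma weight_inner_nonneg: "p \<in> weights \<Longrightarrow> q \<in> weights \<Longrightarrow> 0 \<le> p \<bullet> q"
  by (auto simp: weights_def inner_vec_def intro!: sum_nonneg)

lemma nonzero_weight_coordinate:
  assumes "q \<in> weights - {0}"
  obtains v where "q $ v > 0"
  using assms by (auto simp: weights_def vec_eq_iff less_le)

lemma dominates_coordinates_pos:
  assumes "dominates_coordinates f" "q \<in> weights - {0}"
  shows "f q > 0"
  using assms nonzero_weight_coordinate[OF assms(2)]
  by (metis DiffD1 dominates_coordinates_def less_le_trans)

lemma dominates_coordinates_nonneg:
  assumes "dominates_coordinates f" "q \<in> weights"
  shows "f q \<ge> 0"
  using assms unfolding dominates_coordinates_def weights_def
  by (metis (mono_tags, lifting) mem_Collect_eq order_trans)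

text \<open>
  Each coordinate of \<open>q\<close> is at most \<open>f q\<close>, so the total mass of \<open>p\<close> bounds the
  quotients and the real supremum in the transform is the true one.
\<close>

lemma bdd_above_transform:
  assumes f: "dominates_coordinates f" and p: "p \<in> weights"
  shows "bdd_above ((\<lambda>q. (p \<bullet> q) / f q) ` (weights - {0}))"
proof (rule bdd_aboveI2)
  fix q :: "real ^ 'a" assume q: "q \<in> weights - {0}"
  have "p \<bullet> q \<le> (\<Sum>v\<in>UNIV. p $ v * f q)"
    using f p q unfolding inner_vec_def
    by (auto simp: dominates_coordinates_def weights_def intro!: sum_mono mult_left_mono)
  then show "(p \<bullet> q) / f q \<le> (\<Sum>v\<in>UNIV. p $ v)"
    using dominates_coordinates_pos[OF f q] by (simp add: divide_simps sum_distrib_right)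
qed

text \<open>The multiplicative Fenchel inequality.\<close>

lemma inner_le_transform:
  assumes f: "dominates_coordinates f" and p: "p \<in> weights - {0}" and q: "q \<in> weights"
  shows "p \<bullet> q \<le> f p * transform f q"
proof -
  have "(q \<bullet> p) / f p \<le> transform f q"
    unfolding transform_def by (rule cSUP_upper[OF p bdd_above_transform[OF f q]])
  then show ?thesis
    using dominates_coordinates_pos[OF f p] by (simp add: divide_simps inner_commute mult.commute)
qed

lemma transform_pos:
  assumes f: "dominates_coordinates f" and q: "q \<in> weights - {0}"
  shows "transform f q > 0"
proof -
  have "0 < q \<bullet> q" using q by simp
  also have "\<dots> \<le> f q * transform f q" using inner_le_transform[OF f q] q by blast
  finally show ?thesis
    using dominates_coordinates_pos[OF f q] zero_less_mult_pos by blast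
qed

text \<open>
  This is the inequality \<open>transform (transform f) \<le> f\<close>, stated for the single quotients so that
  it also provides the boundedness of the outer supremum.
\<close>

lemma quotient_transform_le:
  assumes f: "dominates_coordinates f" and p: "p \<in> weights" and q: "q \<in> weights - {0}"
  shows "(p \<bullet> q) / transform f q \<le> f p"
proof (cases "p = 0")
  case True
  then show ?thesis using dominates_coordinates_nonneg[OF f p] by simp
next
  case False
  then have "p \<bullet> q \<le> f p * transform f q"
    using inner_le_transform[OF f] p q by blast
  then show ?thesis using transform_pos[OF f q] by (simp add: divide_simps)
qed

text \<open>A supremum of the linear functions \<open>p \<mapsto> (p \<bullet> q) / transform f q\<close> is convex.\<close>

lemma convex_on_transform_transform:
  fixes f :: "real ^ 'v::finite \<Rightarrow> real"
  assumes f: "dominates_coordinates f"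
  shows "convex_on weights (transform (transform f))"
proof (rule convex_onI[OF _ convex_weights])
  fix t :: real and x y :: "real ^ 'v"
  assume t: "0 < t" "t < 1" and x: "x \<in> weights" and y: "y \<in> weights"
  let ?g = "transform f"
  have upper: "(p \<bullet> q) / ?g q \<le> transform ?g p" if "p \<in> weights" "q \<in> weights - {0}" for p q
    unfolding transform_def[of ?g]
    using that quotient_transform_le[OF f] by (intro cSUP_upper bdd_aboveI2) auto
  show "transform ?g ((1 - t) *\<^sub>R x + t *\<^sub>R y) \<le> (1 - t) * transform ?g x + t * transform ?g y"
    unfolding transform_def[of ?g "(1 - t) *\<^sub>R x + t *\<^sub>R y"]
  proof (rule cSUP_least)
    show "weights - {0 :: real ^ 'v} \<noteq> {}" using axis_in_weights by blast
  next
    fix q :: "real ^ 'v" assume q: "q \<in> weights - {0}"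
    have "((1 - t) *\<^sub>R x + t *\<^sub>R y) \<bullet> q / ?g q = (1 - t) * (x \<bullet> q / ?g q) + t * (y \<bullet> q / ?g q)"
      by (simp add: inner_add_left add_divide_distrib)
    also have "\<dots> \<le> (1 - t) * transform ?g x + t * transform ?g y"
      using t upper[OF x q] upper[OF y q] by (intro add_mono mult_left_mono) auto
    finally show "((1 - t) *\<^sub>R x + t *\<^sub>R y) \<bullet> q / ?g q \<le> (1 - t) * transform ?g x + t * transform ?g y" .
  qed
qed

text \<open>
  The support function of a set of weights is a fixed point, because every member of the set has
  transform at most \<open>1\<close>. The unit vectors in the set make the support function dominate the
  coordinates.
\<close>

lemma transform_transform_max_linear:
  fixes f :: "real ^ 'v::finite \<Rightarrow> real"
  assumes S: "S \<subseteq> weights" and axes: "\<And>v. axis v 1 \<in> S"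
    and le: "\<And>p s. p \<in> weights \<Longrightarrow> s \<in> S \<Longrightarrow> p \<bullet> s \<le> f p"
    and attained: "\<And>p. p \<in> weights \<Longrightarrow> \<exists>s\<in>S. f p = p \<bullet> s"
    and p: "p \<in> weights"
  shows "f p = transform (transform f) p"
proof (rule antisym)
  have f: "dominates_coordinates f"
    unfolding dominates_coordinates_def using le[OF _ axes] by (simp add: inner_axis)
  have bdd: "bdd_above ((\<lambda>q. (p \<bullet> q) / transform f q) ` (weights - {0}))"
    using quotient_transform_le[OF f p] by (intro bdd_aboveI2) auto
  have ne: "weights - {0 :: real ^ 'v} \<noteq> {}" using axis_in_weights by blast
  show "transform (transform f) p \<le> f p"
    unfolding transform_def[of "transform f"]
    using ne quotient_transform_le[OF f p] by (rule cSUP_least)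
  obtain s where s: "s \<in> S" "f p = p \<bullet> s" using attained[OF p] by blast
  show "f p \<le> transform (transform f) p"
  proof (cases "s = 0")
    case True
    \<comment> \<open>The maximiser can be \<open>0\<close> only if \<open>f p = 0\<close>; then any quotient is a lower bound.\<close>
    have "0 \<le> p \<bullet> axis undefined 1 / transform f (axis undefined 1)"
      using weight_inner_nonneg[OF p] transform_pos[OF f axis_in_weights] axis_in_weights
      by (metis DiffD1 divide_nonneg_pos)
    also have "\<dots> \<le> transform (transform f) p"
      unfolding transform_def[of "transform f"] by (rule cSUP_upper[OF axis_in_weights bdd])
    finally show ?thesis using True s by simp
  next
    case False
    then have sw: "s \<in> weights - {0}" using s S by auto
    have "transform f s \<le> 1"
      unfolding transform_def
    proof (rule cSUP_least[OF ne])
      fix r assume r: "r \<in> weights - {0 :: real ^ 'v}"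
      then show "s \<bullet> r / f r \<le> 1"
        using le[of r s] s dominates_coordinates_pos[OF f r] by (simp add: inner_commute)
    qed
    then have "p \<bullet> s \<le> p \<bullet> s / transform f s"
      using weight_inner_nonneg[OF p, of s] sw transform_pos[OF f sw]
      by (simp add: le_divide_eq mult_left_le)
    also have "\<dots> \<le> transform (transform f) p"
      unfolding transform_def[of "transform f"] by (rule cSUP_upper[OF sw bdd])
    finally show ?thesis using s by simp
  qed
qed

section \<open>Weighted independence numbers as maxima\<close>

lemma finite_independent_sums:
  assumes "finite V"
  shows "finite {\<Sum>v\<in>I. p v | I. I \<subseteq> V \<and> independent E I}"
proof -
  have "{\<Sum>v\<in>I. p v | I. I \<subseteq> V \<and> independent E I} \<subseteq> (\<lambda>I. \<Sum>v\<in>I. p v) ` Pow V"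
    by auto
  then show ?thesis using assms by (meson finite_Pow_iff finite_imageI finite_subset)
qed

lemma weighted_indep_upper:
  assumes "finite V" "I \<subseteq> V" "independent E I"
  shows "(\<Sum>v\<in>I. p v) \<le> weighted_indep V E p"
  unfolding weighted_indep_def using assms by (intro Max_ge finite_independent_sums) auto

lemma weighted_indep_attained:
  assumes "finite V"
  obtains I where "I \<subseteq> V" "independent E I" "weighted_indep V E p = (\<Sum>v\<in>I. p v)"
proof -
  have "{\<Sum>v\<in>I. p v | I. I \<subseteq> V \<and> independent E I} \<noteq> {}"
    by (auto intro!: exI[of _ "{}"] simp: independent_def)
  from Max_in[OF finite_independent_sums[OF assms] this] show ?thesis
    using that unfolding weighted_indep_def by blast
qed

section \<open>The three equalities\<close>

lemma independence_number_transform: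
  fixes E :: "'v::finite adj"
  assumes "p \<in> weights"
  shows "independence_number E p = transform (transform (independence_number E)) p"
proof (rule transform_transform_max_linear[where S = "{\<chi> v. of_bool (v \<in> I) | I. independent E I}"])
  have inner: "p \<bullet> (\<chi> v. of_bool (v \<in> I)) = (\<Sum>v\<in>I. p $ v)" for p :: "real ^ 'v" and I
    by (simp add: inner_vec_def if_distrib sum.If_cases of_bool_def cong: if_cong)
  show "axis v 1 \<in> {\<chi> v. of_bool (v \<in> I) | I. independent E I}" for v
    by (auto intro!: exI[of _ "{v}"] simp: independent_def axis_def vec_eq_iff)
  show "p \<bullet> s \<le> independence_number E p" if "s \<in> {\<chi> v. of_bool (v \<in> I) | I. independent E I}" for p s
    using that weighted_indep_upper[of UNIV _ E "\<lambda>v. p $ v"]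
    by (auto simp: inner independence_number_def)
  show "\<exists>s\<in>{\<chi> v. of_bool (v \<in> I) | I. independent E I}. independence_number E p = p \<bullet> s" for p
  proof -
    obtain I where "independent E I" "independence_number E p = (\<Sum>v\<in>I. p $ v)"
      using weighted_indep_attained[of UNIV E "\<lambda>v. p $ v"]
      unfolding independence_number_def by (metis finite)
    then show ?thesis unfolding inner[symmetric] by blast
  qed
qed (use assms in \<open>auto simp: weights_def\<close>)

lemma axis_fractional_packing:
  "axis v 1 \<in> fractional_packings E"
proof -
  have "(\<Sum>w\<in>C. axis v 1 $ w) \<le> (1::real)" for C
  proof -
    have "(\<Sum>w\<in>C. axis v 1 $ w) \<le> (\<Sum>w\<in>UNIV. axis v 1 $ w :: real)"
      by (intro sum_mono2) (auto simp: axis_def)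
    then show ?thesis by (simp add: axis_def)
  qed
  then show ?thesis by (simp add: fractional_packings_def) (simp add: axis_def)
qed

lemma fractional_packing_number_transform:
  assumes "p \<in> weights"
  shows "fractional_packing_number E p = transform (transform (fractional_packing_number E)) p"
proof (rule transform_transform_max_linear[OF _ axis_fractional_packing _ _ assms])
  show "fractional_packings E \<subseteq> weights"
    by (auto simp: fractional_packings_def weights_def)
  show "p \<bullet> s \<le> fractional_packing_number E p" if "s \<in> fractional_packings E" for p s
    using fractional_packing_number_attained[of E p] that by (auto simp: inner_vec_def)
  show "\<exists>s\<in>fractional_packings E. fractional_packing_number E p = p \<bullet> s" for p
    using fractional_packing_number_attained[of E p] by (auto simp: inner_vec_def)
qed

lemma lovasz_number_transform:
  fixes E :: "'v::finite adj"
  assumes "p \<in> weights"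
  shows "lovasz_number E p = transform (transform (lovasz_number E)) p"
proof -
  define S where "S = {\<chi> v. \<bar>c \<bullet> \<psi> v\<bar>\<^sup>2 | c \<psi>. norm c = 1 \<and> orthonormal_rep (complement E) \<psi>}"
  have inner: "p \<bullet> (\<chi> v. \<bar>c \<bullet> \<psi> v\<bar>\<^sup>2) = (\<Sum>v\<in>UNIV. p $ v * \<bar>c \<bullet> \<psi> v\<bar>\<^sup>2)" for p c :: "real ^ 'v" and \<psi>
    by (simp add: inner_vec_def)
  show ?thesis
  proof (rule transform_transform_max_linear[OF _ _ _ _ assms])
    show "S \<subseteq> weights" by (auto simp: S_def weights_def)
    \<comment> \<open>an orthonormal basis represents every graph; the handle \<open>c\<close> is its \<open>v\<close>-th member\<close>
    show "axis v 1 \<in> S" for v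
      unfolding S_def
      by (intro CollectI exI[of _ "axis v 1"] exI[of _ "\<lambda>v. axis v 1"])
         (auto simp: orthonormal_rep_def orthogonal_def inner_axis_axis vec_eq_iff, simp add: axis_def)
    show "p \<bullet> s \<le> lovasz_number E p" if s: "s \<in> S" for p s
    proof -
      obtain d \<phi> where d: "norm d = 1 \<and> orthonormal_rep (complement E) \<phi>" "s = (\<chi> v. \<bar>d \<bullet> \<phi> v\<bar>\<^sup>2)"
        using s unfolding S_def by blast
      show ?thesis
        using lovasz_number_attained[of E p] d(1) unfolding d(2) inner by (metis (no_types, lifting))
    qed
    show "\<exists>s\<in>S. lovasz_number E p = p \<bullet> s" for p
    proof -
      obtain c \<psi> where c: "norm c = 1" "orthonormal_rep (complement E) \<psi>"
        "lovasz_number E p = (\<Sum>v\<in>UNIV. p $ v * \<bar>c \<bullet> \<psi> v\<bar>\<^sup>2)"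
        using lovasz_number_attained[of E p] by blast
      then show ?thesis unfolding S_def
        by (intro bexI[of _ "\<chi> v. \<bar>c \<bullet> \<psi> v\<bar>\<^sup>2"]) (auto simp: inner_vec_def)
    qed
  qed
qed

section \<open>Existence of the limit defining the Shannon capacity\<close>

text \<open>
  Fekete's lemma: iterating superadditivity along division with remainder by a fixed \<open>k\<close> shows
  that \<open>b n\<close> grows at least like \<open>n * (b k / k)\<close>, up to an additive constant.
\<close>

lemma superadditive_limit:
  fixes b :: "nat \<Rightarrow> real"
  assumes super: "\<And>m n. b m + b n \<le> b (m + n)" and bound: "\<And>n. b n \<le> real n * K"
  shows "(\<lambda>n. b n / real n) \<longlonglongrightarrow> (SUP n\<in>{1..}. b n / real n)" (is "_ \<longlonglongrightarrow> ?L")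
proof -
  have bdd: "bdd_above ((\<lambda>n. b n / real n) ` {1..})"
    using bound by (intro bdd_aboveI2[where M = K]) (auto simp: divide_simps mult.commute)
  show ?thesis
  proof (rule order_tendstoI)
    fix a assume "?L < a"
    then have "b n / real n < a" if "n \<ge> 1" for n
      using cSUP_upper[OF _ bdd, of n] that by auto
    then show "\<forall>\<^sub>F n in sequentially. b n / real n < a"
      by (auto simp: eventually_at_top_linorder)
  next
    fix a assume a: "a < ?L"
    then obtain k where k: "k \<ge> 1" "a < b k / real k"
      using less_cSUP_iff[OF _ bdd, of a] by auto
    define c where "c = b k / real k"
    \<comment> \<open>the largest loss caused by a remainder modulo \<open>k\<close>\<close>
    define D where "D = Max ((\<lambda>r. real r * c - b r) ` {..<k})"
    have mult: "real q * b k + b r \<le> b (q * k + r)" for q r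
    proof (induction q)
      case (Suc q)
      then show ?case using super[of k "q * k + r"] by (simp add: algebra_simps)
    qed simp
    have lower: "real n * c - D \<le> b n" for n
    proof -
      have "real (n mod k) * c - b (n mod k) \<le> D"
        unfolding D_def using k by (intro Max_ge) auto
      moreover have "real (n div k) * b k + b (n mod k) \<le> b n"
        using mult[of "n div k" "n mod k"] by simp
      moreover have "real n * c = real (n div k) * b k + real (n mod k) * c"
      proof -
        have "real n = real (n div k) * real k + real (n mod k)"
          by (metis div_mult_mod_eq of_nat_add of_nat_mult)
        then show ?thesis using k by (simp add: c_def field_simps)
      qed
      ultimately show ?thesis by linarith
    qed
    have "(\<lambda>n. c - D / real n) \<longlonglongrightarrow> c - 0"
      by (intro tendsto_diff tendsto_const lim_const_over_n)
    then have "\<forall>\<^sub>F n in sequentially. a < c - D / real n"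
      using k by (intro order_tendstoD(1)) (auto simp: c_def)
    then show "\<forall>\<^sub>F n in sequentially. a < b n / real n"
      using eventually_gt_at_top[of 0]
    proof eventually_elim
      case (elim n)
      have "c - D / real n = (real n * c - D) / real n"
        using elim by (simp add: field_simps)
      also have "\<dots> \<le> b n / real n"
        using lower by (intro divide_right_mono) auto
      finally show ?case using elim by linarith
    qed
  qed
qed

text \<open>
  The exponential form of Fekete's lemma. The exponential bound keeps the limit of the logarithms
  finite.
\<close>

lemma supermultiplicative_root_convergent:
  fixes a :: "nat \<Rightarrow> real"
  assumes pos: "\<And>n. 0 < a n" and super: "\<And>m n. a m * a n \<le> a (m + n)"
    and bound: "\<And>n. a n \<le> C ^ n" and C: "0 < C"
  shows "convergent (\<lambda>n. root n (a n))"
proof -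
  have 1: "ln (a m) + ln (a n) \<le> ln (a (m + n))" for m n
    using super[of m n] pos[of m] pos[of n] pos[of "m + n"]
    by (simp add: ln_mult_pos[symmetric])
  have 2: "ln (a n) \<le> real n * ln C" for n
    using bound[of n] pos[of n] C by (simp add: ln_realpow[symmetric])
  obtain L where "(\<lambda>n. ln (a n) / real n) \<longlonglongrightarrow> L"
    using superadditive_limit[of "\<lambda>n. ln (a n)", OF 1 2] by blast
  then have "(\<lambda>n. exp (ln (a n) / real n)) \<longlonglongrightarrow> exp L" by (rule tendsto_exp)
  moreover have "\<forall>\<^sub>F n in sequentially. exp (ln (a n) / real n) = root n (a n)"
    using eventually_gt_at_top[of 0]
  proof eventually_elim
    case (elim n)
    then show ?case using pos[of n] by (simp add: root_powr_inverse powr_def)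
  qed
  ultimately have "(\<lambda>n. root n (a n)) \<longlonglongrightarrow> exp L" by (rule Lim_transform_eventually)
  then show ?thesis by (rule convergentI)
qed

section \<open>Strong powers\<close>

lemma finite_power_verts: "finite (power_verts m :: 'v::finite list set)"
  unfolding power_verts_def using finite_lists_length_eq[of "UNIV :: 'v set" m] by simp

text \<open>
  In terms of whole lists, adjacency no longer refers to the order in which the factors are
  multiplied, and it splits along concatenation.
\<close>

lemma strong_power_iff:
  assumes "irreflp E" "length us = m" "length vs = m"
  shows "strong_power E m us vs \<longleftrightarrow> us \<noteq> vs \<and> list_all2 (\<lambda>u v. u = v \<or> E u v) us vs"
  using assms(2,3)
proof (induction m arbitrary: us vs)
  case (Suc m)
  then obtain u us' v vs' where "us = u # us'" "vs = v # vs'" "length us' = m" "length vs' = m"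
    by (metis length_Suc_conv)
  moreover have "list_all2 (\<lambda>u v. u = v \<or> E u v) vs' vs'"
    by (simp add: list_all2_refl)
  ultimately show ?case using Suc.IH[of us' vs'] assms(1)
    by (auto simp: strong_prod_def irreflp_def)
qed auto

text \<open>
  If two concatenations were adjacent, both their parts would be equal or adjacent, hence equal by
  independence.
\<close>

lemma independent_append:
  assumes E: "irreflp E" and I: "I \<subseteq> power_verts m" "independent (strong_power E m) I"
    and J: "J \<subseteq> power_verts n" "independent (strong_power E n) J"
  shows "independent (strong_power E (m + n)) ((\<lambda>(us, vs). us @ vs) ` (I \<times> J))"
  unfolding independent_def
proof (rule pairwiseI)
  fix x y
  assume xy: "x \<in> (\<lambda>(us, vs). us @ vs) ` (I \<times> J)" "y \<in> (\<lambda>(us, vs). us @ vs) ` (I \<times> J)" "x \<noteq> y"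
  then obtain us vs us' vs' where eq: "x = us @ vs" "y = us' @ vs'"
    and mem: "us \<in> I" "us' \<in> I" "vs \<in> J" "vs' \<in> J" by auto
  have len: "length us = m" "length us' = m" "length vs = n" "length vs' = n"
    using mem I(1) J(1) by (auto simp: power_verts_def)
  show "\<not> strong_power E (m + n) x y"
  proof
    assume "strong_power E (m + n) x y"
    then have "list_all2 (\<lambda>u v. u = v \<or> E u v) us us'" "list_all2 (\<lambda>u v. u = v \<or> E u v) vs vs'"
      using len by (auto simp: eq strong_power_iff[OF E] list_all2_append)
    then have "us = us'" "vs = vs'"
      using I(2) J(2) mem len strong_power_iff[OF E]
      unfolding independent_def pairwise_def by metis+
    then show False using xy(3) eq by simp
  qed
qed

abbreviation power_indep :: "'v::finite adj \<Rightarrow> real ^ 'v \<Rightarrow> nat \<Rightarrow> real" where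
  "power_indep E p m \<equiv>
     weighted_indep (power_verts m) (strong_power E m) (\<lambda>vs. \<Prod>v\<leftarrow>vs. p $ v)"

lemma power_indep_supermultiplicative:
  assumes E: "irreflp E"
  shows "power_indep E p m * power_indep E p n \<le> power_indep E p (m + n)"
proof -
  obtain I where I: "I \<subseteq> power_verts m" "independent (strong_power E m) I"
    "power_indep E p m = (\<Sum>vs\<in>I. \<Prod>v\<leftarrow>vs. p $ v)"
    using weighted_indep_attained[OF finite_power_verts] .
  obtain J where J: "J \<subseteq> power_verts n" "independent (strong_power E n) J"
    "power_indep E p n = (\<Sum>vs\<in>J. \<Prod>v\<leftarrow>vs. p $ v)"
    using weighted_indep_attained[OF finite_power_verts] .
  have inj: "inj_on (\<lambda>(us, vs). us @ vs) (I \<times> J)"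
    using I(1) by (auto simp: inj_on_def power_verts_def subset_iff)
  have "power_indep E p m * power_indep E p n = (\<Sum>(us, vs)\<in>I \<times> J. (\<Prod>v\<leftarrow>us. p $ v) * (\<Prod>v\<leftarrow>vs. p $ v))"
    by (simp add: I(3) J(3) sum_product sum.cartesian_product)
  also have "\<dots> = (\<Sum>ws\<in>(\<lambda>(us, vs). us @ vs) ` (I \<times> J). \<Prod>v\<leftarrow>ws. p $ v)"
    by (subst sum.reindex[OF inj]) (auto intro!: sum.cong)
  also have "\<dots> \<le> power_indep E p (m + n)"
    using I(1) J(1)
    by (intro weighted_indep_upper finite_power_verts independent_append[OF E I(1,2) J(1,2)])
       (auto simp: power_verts_def subset_iff)
  finally show ?thesis .
qed

text \<open>A repeated vertex forms an independent set by itself.\<close>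

lemma power_indep_ge: "(p $ v) ^ m \<le> power_indep E p m"
proof -
  have "(\<Sum>vs\<in>{replicate m v}. \<Prod>v\<leftarrow>vs. p $ v) \<le> power_indep E p m"
    by (intro weighted_indep_upper finite_power_verts) (auto simp: power_verts_def independent_def)
  then show ?thesis by (simp add: prod_list_replicate)
qed

text \<open>
  A crude exponential bound suffices for the limit to be finite: there are \<open>CARD('v) ^ m\<close>
  lists of length \<open>m\<close>, and every entry of \<open>p\<close> is at most the total mass.
\<close>

lemma power_indep_le:
  fixes p :: "real ^ 'v::finite"
  assumes p: "p \<in> weights"
  shows "power_indep E p m \<le> (real CARD('v) * (\<Sum>v\<in>UNIV. p $ v)) ^ m"
proof -
  let ?C = "\<Sum>v\<in>UNIV. p $ v"
  have p0: "0 \<le> p $ v" for v using p by (simp add: weights_def)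
  have pC: "p $ v \<le> ?C" for v using p0 by (intro member_le_sum) auto
  have C0: "0 \<le> ?C" using p0 by (intro sum_nonneg) auto
  have prod: "0 \<le> (\<Prod>v\<leftarrow>vs. p $ v) \<and> (\<Prod>v\<leftarrow>vs. p $ v) \<le> ?C ^ length vs" for vs
    using p0 pC C0 by (induction vs) (auto intro!: mult_mono)
  obtain I where I: "I \<subseteq> power_verts m" "power_indep E p m = (\<Sum>vs\<in>I. \<Prod>v\<leftarrow>vs. p $ v)"
    using weighted_indep_attained[OF finite_power_verts] by metis
  have "power_indep E p m \<le> (\<Sum>vs\<in>power_verts m. \<Prod>v\<leftarrow>vs. p $ v)"
    unfolding I(2) using I(1) prod by (intro sum_mono2 finite_power_verts) auto
  also have "\<dots> \<le> (\<Sum>vs\<in>(power_verts m :: 'v list set). ?C ^ m)"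
  proof (rule sum_mono)
    fix vs :: "'v list" assume "vs \<in> power_verts m"
    then show "(\<Prod>v\<leftarrow>vs. p $ v) \<le> ?C ^ m"
      using prod[of vs] by (simp add: power_verts_def)
  qed
  also have "\<dots> = (real CARD('v) * ?C) ^ m"
    using card_lists_length_eq[of "UNIV :: 'v set" m]
    by (simp add: power_verts_def power_mult_distrib)
  finally show ?thesis .
qed

section \<open>The Shannon capacity\<close>

text \<open>
  The logarithms needed for Fekete's lemma are available only for a nonzero weight; for the zero
  weight the sequence vanishes identically.
\<close>

lemma shannon_capacity_tendsto:
  fixes p :: "real ^ 'v::finite"
  assumes E: "irreflp E" and p: "p \<in> weights"
  shows "(\<lambda>m. root m (power_indep E p m)) \<longlonglongrightarrow> shannon_capacity E p"
proof (cases "p = 0")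
  case True
  \<comment> \<open>for \<open>m = 0\<close> the independence number is \<open>1\<close>, but \<open>root 0\<close> is \<open>0\<close> by convention\<close>
  have "root m (power_indep E p m) = 0" for m
  proof (cases m)
    case (Suc k)
    have "power_indep E p m \<le> 0"
      using power_indep_le[OF p, of m] True Suc by simp
    moreover have "0 \<le> power_indep E p m"
      using power_indep_ge[of p undefined m] True Suc by simp
    ultimately have "power_indep E p m = 0" by (rule antisym)
    then show ?thesis by simp
  qed simp
  then show ?thesis by (simp add: shannon_capacity_def limI)
next
  case False
  then obtain v where v: "p $ v > 0" using p nonzero_weight_coordinate by blast
  have p0: "0 \<le> p $ v" for v using p by (simp add: weights_def)
  have "0 < (\<Sum>v\<in>UNIV. p $ v)" using v p0 by (intro sum_pos2[of _ v]) auto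
  then have C: "0 < real CARD('v) * (\<Sum>v\<in>UNIV. p $ v)" by simp
  have pos: "0 < power_indep E p m" for m
    using power_indep_ge[of p v m] v by (meson less_le_trans zero_less_power)
  show ?thesis
    unfolding shannon_capacity_def convergent_LIMSEQ_iff[symmetric]
    by (rule supermultiplicative_root_convergent
        [OF pos power_indep_supermultiplicative[OF E] power_indep_le[OF p] C])
qed

lemma shannon_capacity_dominates_coordinates:
  assumes E: "irreflp E"
  shows "dominates_coordinates (shannon_capacity E)"
  unfolding dominates_coordinates_def
proof (intro ballI allI)
  fix p :: "real ^ 'a" and v assume p: "p \<in> weights"
  have "p $ v \<le> root m (power_indep E p m)" if "m \<ge> 1" for m
  proof -
    have "p $ v = root m ((p $ v) ^ m)"
      using that p by (simp add: weights_def real_root_power_cancel)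
    also have "\<dots> \<le> root m (power_indep E p m)"
      using that power_indep_ge[of p v m] by simp
    finally show ?thesis .
  qed
  then show "p $ v \<le> shannon_capacity E p"
    by (intro LIMSEQ_le_const[OF shannon_capacity_tendsto[OF E p]]) blast
qed

theorem corollary5:
  fixes E :: "'v::finite \<Rightarrow> 'v \<Rightarrow> bool"
  assumes "symp E" and "irreflp E"
  shows "(\<forall>p \<in> weights. independence_number E p = transform (transform (independence_number E)) p) \<and>
    (\<forall>p \<in> weights.
       fractional_packing_number E p = transform (transform (fractional_packing_number E)) p) \<and>
    (\<forall>p \<in> weights. lovasz_number E p = transform (transform (lovasz_number E)) p) \<and>
    (\<not> convex_on weights (shannon_capacity E) \<longrightarrow>
       \<not> (\<forall>p \<in> weights. shannon_capacity E p = transform (transform (shannon_capacity E)) p))"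
proof -
  have "convex_on weights (shannon_capacity E)"
    if "\<forall>p \<in> weights. shannon_capacity E p = transform (transform (shannon_capacity E)) p"
    using convex_on_transform_transform[OF shannon_capacity_dominates_coordinates[OF assms(2)]] that
    by (simp add: convex_on_def convexD)
  then show ?thesis
    using independence_number_transform fractional_packing_number_transform lovasz_number_transform
    by blast
qed

end
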